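(* Let $G$ be a GSOS language (a finite signature together with a finite set of GSOS rules). Then for all initial transition formulae $F$ and $F'$, it is decidable whether $\models_G F \Rightarrow F'$ holds.
   Context: Initial transition formulae are given by the grammar $F ::= \mathsf{True} \mid x \xrightarrow{a} \mid \neg F \mid F \wedge F$, where $x$ ranges over process variables and $a$ over the finite set of actions $\mathsf{Act}$. A $G$-model is a closed substitution $\sigma$ mapping variables to closed $\Sigma_G$-terms; satisfaction is defined by structural recursion, with $\to_G,\sigma \models x \xrightarrow{a}$ iff $\sigma(x) \xrightarrow{a}_G p$ for some closed term $p$, where $\to_G$ is the transition relation induced by the rules of $G$. Semantic entailment $\models_G F \Rightarrow F'$ holds iff every closed substitution satisfying $F$ also satisfies $F'$. *)

theory Defs
  imports Main "HOL-Library.Nat_Bijection"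
begin

section \<open>Total recursive functions and decidability\<close>

text \<open>
  The total recursive functions of arity \<open>n\<close>, given as functions on argument lists whose
  values on lists of any other length are irrelevant: the least class containing zero, successor
  and projections that is closed under composition, primitive recursion and
  minimisation of regular functions.
\<close>

inductive recursive :: "nat \<Rightarrow> (nat list \<Rightarrow> nat) \<Rightarrow> bool" where
  zero: "(\<And>xs. length xs = n \<Longrightarrow> f xs = 0) \<Longrightarrow> recursive n f"
| succ: "(\<And>x. f [x] = Suc x) \<Longrightarrow> recursive 1 f"
| proj: "i < n \<Longrightarrow> (\<And>xs. length xs = n \<Longrightarrow> f xs = xs ! i) \<Longrightarrow> recursive n f"
| comp: "recursive (length gs) f \<Longrightarrow> \<forall>g\<in>set gs. recursive n g \<Longrightarrow>
    (\<And>xs. length xs = n \<Longrightarrow> h xs = f (map (\<lambda>g. g xs) gs)) \<Longrightarrow> recursive n h"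
| primitive_recursion: "recursive n f \<Longrightarrow> recursive (Suc (Suc n)) g \<Longrightarrow>
    (\<And>xs. length xs = n \<Longrightarrow> h (0 # xs) = f xs) \<Longrightarrow>
    (\<And>m xs. length xs = n \<Longrightarrow> h (Suc m # xs) = g (m # h (m # xs) # xs)) \<Longrightarrow>
    recursive (Suc n) h"
| minimisation: "recursive (Suc n) f \<Longrightarrow>
    (\<And>xs. length xs = n \<Longrightarrow> \<exists>y. f (y # xs) = 0) \<Longrightarrow>
    (\<And>xs. length xs = n \<Longrightarrow> h xs = (LEAST y. f (y # xs) = 0)) \<Longrightarrow> recursive n h"

text \<open>
  The problem with instance set \<open>I\<close> and yes-instances \<open>{i \<in> I. P i}\<close> is decidable
  when instances are presented as \<open>n\<close>-tuples of numbers by \<open>code\<close>. A decision procedure may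
  answer arbitrarily, but must terminate, on tuples that do not code an instance.
\<close>

definition decidable_on :: "nat \<Rightarrow> ('i \<Rightarrow> nat list) \<Rightarrow> 'i set \<Rightarrow> ('i \<Rightarrow> bool) \<Rightarrow> bool" where
  "decidable_on n code I P \<longleftrightarrow>
    (\<forall>i\<in>I. length (code i) = n) \<and>
    (\<exists>d. recursive n d \<and> (\<forall>i\<in>I. d (code i) = (if P i then 1 else 0)))"


section \<open>GSOS languages\<close>

text \<open>
  Process variables, operation symbols and actions are taken from countably infinite supplies of
  names, all identified with the natural numbers.
\<close>

type_synonym var = nat
type_synonym opsym = nat
type_synonym action = nat

datatype tm = Var var | Op opsym "tm list"

primrec subst :: "(var \<Rightarrow> tm) \<Rightarrow> tm \<Rightarrow> tm" where
  "subst \<sigma> (Var x) = \<sigma> x"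
| "subst \<sigma> (Op f ts) = Op f (map (subst \<sigma>) ts)"

primrec vars :: "tm \<Rightarrow> var set" where
  "vars (Var x) = {x}"
| "vars (Op f ts) = \<Union> (set (map vars ts))"

text \<open>
  The rule with conclusion \<open>f(x\<^sub>1,\<dots>,x\<^sub>l) \<rightarrow>\<^sup>c t\<close>, where \<open>sources\<close> is
  \<open>x\<^sub>1,\<dots>,x\<^sub>l\<close>; an entry \<open>(x, a, y)\<close> of \<open>pos\<close> is the premise that \<open>x\<close> has an
  \<open>a\<close>-transition to \<open>y\<close>, and an entry \<open>(x, b)\<close> of \<open>neg\<close> the premise that \<open>x\<close> has no
  \<open>b\<close>-transition.
\<close>

record rule =
  oper :: opsym
  sources :: "var list"
  pos :: "(var \<times> action \<times> var) list"
  neg :: "(var \<times> action) list"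
  label :: action
  target :: tm

text \<open>
  The finite sets constituting a language are presented as lists, as they are part of
  the input of a decision procedure. An entry \<open>(f, n)\<close> of \<open>signature\<close> is an operation symbol
  \<open>f\<close> of arity \<open>n\<close>.
\<close>

record language =
  actions :: "action list"
  signature :: "(opsym \<times> nat) list"
  rules :: "rule list"

fun term_over :: "language \<Rightarrow> tm \<Rightarrow> bool" where
  "term_over G (Var x) \<longleftrightarrow> True"
| "term_over G (Op f ts) \<longleftrightarrow>
    (f, length ts) \<in> set (signature G) \<and> (\<forall>t\<in>set ts. term_over G t)"

definition closed_term :: "language \<Rightarrow> tm \<Rightarrow> bool" where
  "closed_term G p \<longleftrightarrow> term_over G p \<and> vars p = {}"

definition gsos_rule :: "language \<Rightarrow> rule \<Rightarrow> bool" where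
  "gsos_rule G r \<longleftrightarrow>
    (let ys = map (\<lambda>(x, a, y). y) (pos r) in
      (oper r, length (sources r)) \<in> set (signature G) \<and>
      distinct (sources r @ ys) \<and>
      (\<forall>(x, a, y)\<in>set (pos r). x \<in> set (sources r) \<and> a \<in> set (actions G)) \<and>
      (\<forall>(x, b)\<in>set (neg r). x \<in> set (sources r) \<and> b \<in> set (actions G)) \<and>
      label r \<in> set (actions G) \<and>
      term_over G (target r) \<and>
      vars (target r) \<subseteq> set (sources r) \<union> set ys)"

definition gsos_language :: "language \<Rightarrow> bool" where
  "gsos_language G \<longleftrightarrow>
    distinct (map fst (signature G)) \<and> (\<forall>r\<in>set (rules G). gsos_rule G r)"

lemma gsos_rule_premises:
  assumes "gsos_rule G r"
  shows "(x, a, y) \<in> set (pos r) \<Longrightarrow> x \<in> set (sources r)"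
    and "(x, b) \<in> set (neg r) \<Longrightarrow> x \<in> set (sources r)"
  using assms unfolding gsos_rule_def Let_def by blast+

text \<open>
  Premises test proper subterms of the source only, so the transition relation, although rules
  have negative premises, is determined by structural recursion on the source. The
  condition \<open>gsos_rule G r\<close> holds for every rule of a GSOS language; it is repeated here to make
  the recursion well-founded for arbitrary \<open>G\<close>. Targets of transitions from closed terms
  are closed, so \<open>\<sigma>\<close> and \<open>p\<close> need not be restricted.
\<close>

declare conj_cong [fundef_cong]

function step :: "language \<Rightarrow> tm \<Rightarrow> action \<Rightarrow> tm \<Rightarrow> bool" where
  "step G (Var x) c q \<longleftrightarrow> False"
| "step G (Op f ts) c q \<longleftrightarrow>
    (\<exists>r \<sigma>. (r \<in> set (rules G) \<and> gsos_rule G r \<and>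
        oper r = f \<and> map \<sigma> (sources r) = ts \<and> label r = c \<and> subst \<sigma> (target r) = q) \<and>
      (\<forall>x a y. (x, a, y) \<in> set (pos r) \<longrightarrow> step G (\<sigma> x) a (\<sigma> y)) \<and>
      (\<forall>x b. (x, b) \<in> set (neg r) \<longrightarrow> \<not> (\<exists>p. step G (\<sigma> x) b p)))"
  by pat_completeness auto
termination
proof (relation "measure (\<lambda>(G, p, c, q). size p)", goal_cases)
  case 1
  then show ?case by simp
next
  case prems: (2 G f ts c q r \<sigma> x a y)
  then have "x \<in> set (sources r)"
    using gsos_rule_premises by blast
  with prems have "\<sigma> x \<in> set ts" by auto
  then have "size (\<sigma> x) \<le> size_list size ts"
    by (simp add: size_list_estimation')
  then show ?case by simp
next
  case prems: (3 G f ts c q r \<sigma> x b p)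
  then have "x \<in> set (sources r)"
    using gsos_rule_premises by blast
  with prems have "\<sigma> x \<in> set ts" by auto
  then have "size (\<sigma> x) \<le> size_list size ts"
    by (simp add: size_list_estimation')
  then show ?case by simp
qed


section \<open>Initial transition formulae\<close>

datatype form = TrueF | CanF var action | NotF form | AndF form form

primrec form_over :: "language \<Rightarrow> form \<Rightarrow> bool" where
  "form_over G TrueF \<longleftrightarrow> True"
| "form_over G (CanF x a) \<longleftrightarrow> a \<in> set (actions G)"
| "form_over G (NotF F) \<longleftrightarrow> form_over G F"
| "form_over G (AndF F F') \<longleftrightarrow> form_over G F \<and> form_over G F'"

definition model :: "language \<Rightarrow> (var \<Rightarrow> tm) \<Rightarrow> bool" where
  "model G \<sigma> \<longleftrightarrow> (\<forall>x. closed_term G (\<sigma> x))"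

primrec sat :: "language \<Rightarrow> (var \<Rightarrow> tm) \<Rightarrow> form \<Rightarrow> bool" where
  "sat G \<sigma> TrueF \<longleftrightarrow> True"
| "sat G \<sigma> (CanF x a) \<longleftrightarrow> (\<exists>p. closed_term G p \<and> step G (\<sigma> x) a p)"
| "sat G \<sigma> (NotF F) \<longleftrightarrow> \<not> sat G \<sigma> F"
| "sat G \<sigma> (AndF F F') \<longleftrightarrow> sat G \<sigma> F \<and> sat G \<sigma> F'"

definition entails :: "language \<Rightarrow> form \<Rightarrow> form \<Rightarrow> bool" where
  "entails G F F' \<longleftrightarrow> (\<forall>\<sigma>. model G \<sigma> \<longrightarrow> sat G \<sigma> F \<longrightarrow> sat G \<sigma> F')"


section \<open>Goedel numbering\<close>

primrec tm_code :: "tm \<Rightarrow> nat" where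
  "tm_code (Var x) = prod_encode (0, x)"
| "tm_code (Op f ts) = prod_encode (1, prod_encode (f, list_encode (map tm_code ts)))"

definition rule_code :: "rule \<Rightarrow> nat" where
  "rule_code r = list_encode
    [oper r, list_encode (sources r),
     list_encode (map (\<lambda>(x, a, y). prod_encode (x, prod_encode (a, y))) (pos r)),
     list_encode (map prod_encode (neg r)), label r, tm_code (target r)]"

definition language_code :: "language \<Rightarrow> nat" where
  "language_code G = list_encode
    [list_encode (actions G), list_encode (map prod_encode (signature G)),
     list_encode (map rule_code (rules G))]"

primrec form_code :: "form \<Rightarrow> nat" where
  "form_code TrueF = prod_encode (0, 0)"
| "form_code (CanF x a) = prod_encode (1, prod_encode (x, a))"
| "form_code (NotF F) = prod_encode (2, form_code F)"
| "form_code (AndF F F') = prod_encode (3, prod_encode (form_code F, form_code F'))"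

lemma tm_code_inject: "tm_code s = tm_code t \<longleftrightarrow> s = t"
proof (induction s arbitrary: t)
  case (Var x)
  then show ?case by (cases t) (auto simp: prod_encode_eq)
next
  case (Op f ss)
  show ?case
  proof (cases t)
    case t: (Op g ts)
    have "map tm_code ss = map tm_code ts \<longleftrightarrow> ss = ts"
      using list.inj_map_strong[of ss ts tm_code tm_code] Op.IH by blast
    with t show ?thesis by (auto simp: prod_encode_eq list_encode_eq)
  qed (auto simp: prod_encode_eq)
qed

lemma rule_code_inject: "rule_code r = rule_code s \<longleftrightarrow> r = s"
proof -
  have "inj (\<lambda>(x, a, y). prod_encode (x, prod_encode (a, y)))"
    by (auto simp: inj_def prod_encode_eq)
  then show ?thesis
    by (cases r; cases s)
      (auto simp: rule_code_def list_encode_eq tm_code_inject inj_map_eq_map inj_prod_encode)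
qed

lemma language_code_inject: "language_code G = language_code H \<longleftrightarrow> G = H"
proof -
  have "inj rule_code"
    by (simp add: inj_def rule_code_inject)
  then show ?thesis
    by (cases G; cases H)
      (auto simp: language_code_def list_encode_eq inj_map_eq_map inj_prod_encode)
qed

lemma form_code_inject: "form_code F = form_code F' \<longleftrightarrow> F = F'"
proof (induction F arbitrary: F')
  case TrueF
  then show ?case by (cases F') (auto simp: prod_encode_eq)
next
  case (CanF x a)
  then show ?case by (cases F') (auto simp: prod_encode_eq)
next
  case (NotF F)
  then show ?case by (cases F') (auto simp: prod_encode_eq)
next
  case (AndF F1 F2)
  then show ?case by (cases F') (auto simp: prod_encode_eq)
qed


section \<open>Fixing a parameter of a decidable problem\<close>

lemma recursive_const: "recursive n (\<lambda>xs. c)"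
proof (induction c)
  case 0
  show ?case by (rule recursive.zero) simp
next
  case (Suc c)
  let ?gs = "[\<lambda>xs :: nat list. c]"
  show ?case
  proof (rule recursive.comp)
    have "recursive 1 (\<lambda>xs. Suc (xs ! 0))"
      by (rule recursive.succ) simp
    then show "recursive (length ?gs) (\<lambda>xs. Suc (xs ! 0))"
      by simp
    show "\<forall>g\<in>set ?gs. recursive n g"
      using Suc by simp
    show "Suc c = Suc (map (\<lambda>g. g xs) ?gs ! 0)" for xs
      by simp
  qed
qed

lemma decidable_on_fix:
  assumes dec: "decidable_on (Suc n) code I P"
    and inst: "\<And>j. j \<in> J \<Longrightarrow> e j \<in> I \<and> code (e j) = c # code' j"
  shows "decidable_on n code' J (\<lambda>j. P (e j))"
proof -
  from dec obtain d where d: "recursive (Suc n) d"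
    and correct: "\<And>i. i \<in> I \<Longrightarrow> length (code i) = Suc n"
      "\<And>i. i \<in> I \<Longrightarrow> d (code i) = (if P i then 1 else 0)"
    unfolding decidable_on_def by blast
  define gs where "gs = (\<lambda>xs. c) # map (\<lambda>i xs. xs ! i) [0..<n]"
  have "recursive n (\<lambda>xs. d (c # xs))"
  proof (rule recursive.comp[where gs = gs and f = d])
    show "recursive (length gs) d"
      using d by (simp add: gs_def)
    have "recursive n (\<lambda>xs. xs ! i)" if "i < n" for i
      using that by (rule recursive.proj) simp
    then show "\<forall>g\<in>set gs. recursive n g"
      by (simp add: gs_def recursive_const)
    show "d (c # xs) = d (map (\<lambda>g. g xs) gs)" if "length xs = n" for xs
    proof -
      have "map ((!) xs) [0..<n] = xs"
        using that map_nth by blast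
      then show ?thesis by (simp add: gs_def comp_def)
    qed
  qed
  moreover have "length (code' j) = n \<and> d (c # code' j) = (if P (e j) then 1 else 0)"
    if "j \<in> J" for j
    using inst[OF that] correct[of "e j"] by (metis length_Cons nat.inject)
  ultimately show ?thesis
    using inst correct(2) unfolding decidable_on_def by blast
qed

lemma entailment_decidable_for_fixed_language:
  assumes "decidable_on 3
      (\<lambda>(G, F, F'). [language_code G, form_code F, form_code F'])
      {(G, F, F'). gsos_language G \<and> form_over G F \<and> form_over G F'}
      (\<lambda>(G, F, F'). entails G F F')"
    and "gsos_language G"
  shows "decidable_on 2 (\<lambda>(F, F'). [form_code F, form_code F'])
      {(F, F'). form_over G F \<and> form_over G F'} (\<lambda>(F, F'). entails G F F')"
proof -
  let ?code = "\<lambda>(G, F, F'). [language_code G, form_code F, form_code F']"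
  let ?code' = "\<lambda>(F, F'). [form_code F, form_code F']"
  let ?I = "{(G, F, F'). gsos_language G \<and> form_over G F \<and> form_over G F'}"
  let ?J = "{(F, F'). form_over G F \<and> form_over G F'}"
  have "decidable_on (Suc 2) ?code ?I (\<lambda>(G, F, F'). entails G F F')"
    using assms(1) by simp
  moreover have "(G, j) \<in> ?I \<and> ?code (G, j) = language_code G # ?code' j" if "j \<in> ?J" for j
    using that assms(2) by (cases j) simp
  ultimately have "decidable_on 2 ?code' ?J (\<lambda>j. (\<lambda>(G, F, F'). entails G F F') (G, j))"
    by (rule decidable_on_fix)
  then show ?thesis by simp
qed

end

theory Submission
  imports Defs
begin

text \<open>
  Whether \<open>\<sigma>\<close> satisfies an initial transition formula depends only on the sets of initial
  actions of the terms \<open>\<sigma> x\<close>. By the GSOS format, the initial actions of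
  \<open>f(p\<^sub>1,\<dots>,p\<^sub>n)\<close> are determined by \<open>f\<close> and the initial actions of the \<open>p\<^sub>i\<close>, because the
  targets of the premises of a rule are distinct variables and can be chosen independently. So the
  realisable sets of initial actions form the least family \<open>S\<close> of sets of labels that is closed
  under finitely many operations on a finite set, and entailment holds iff some closed family \<open>S\<close>
  validates \<open>F \<Rightarrow> F'\<close> under all valuations of the variables in \<open>S\<close>. With sets of numbers coded as
  bit masks, this is an arithmetical formula with computably bounded quantifiers only.
\<close>

section \<open>Closure properties of computable functions\<close>

lemma recursive_compose1:
  assumes "recursive 1 (\<lambda>xs. f (xs ! 0))" "recursive n a"
  shows "recursive n (\<lambda>xs. f (a xs))"
  by (rule recursive.comp[where gs = "[a]" and f = "\<lambda>xs. f (xs ! 0)"]) (use assms in simp_all)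

lemma recursive_compose2:
  assumes "recursive 2 (\<lambda>xs. f (xs ! 0) (xs ! 1))" "recursive n a" "recursive n b"
  shows "recursive n (\<lambda>xs. f (a xs) (b xs))"
  by (rule recursive.comp[where gs = "[a, b]" and f = "\<lambda>xs. f (xs ! 0) (xs ! 1)"])
    (use assms in \<open>simp_all add: numeral_2_eq_2\<close>)

lemma recursive_nth: "i < n \<Longrightarrow> recursive n (\<lambda>xs. xs ! i)"
  by (rule recursive.proj) simp_all

lemma recursive_Suc: "recursive n a \<Longrightarrow> recursive n (\<lambda>xs. Suc (a xs))"
  by (rule recursive_compose1[where f = Suc]) (rule recursive.succ, simp)

text \<open>One parameter besides the recursion argument is enough for what follows, since it can
  hold a whole environment coded as a single number.\<close>

lemma recursive_rec_nat2:
  assumes a: "recursive 1 (\<lambda>xs. a (xs ! 0))"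
    and g: "recursive 3 (\<lambda>xs. g (xs ! 0) (xs ! 1) (xs ! 2))"
  shows "recursive 2 (\<lambda>xs. rec_nat (a (xs ! 1)) (\<lambda>m r. g m r (xs ! 1)) (xs ! 0))"
  using recursive.primitive_recursion[of 1 "\<lambda>xs. a (xs ! 0)"
      "\<lambda>xs. g (xs ! 0) (xs ! 1) (xs ! 2)"
      "\<lambda>xs. rec_nat (a (xs ! 1)) (\<lambda>m r. g m r (xs ! 1)) (xs ! 0)"] a g
  by (simp add: numeral_2_eq_2 numeral_3_eq_3)

lemma recursive_add:
  assumes "recursive n a" "recursive n b"
  shows "recursive n (\<lambda>xs. a xs + b xs)"
proof (rule recursive_compose2[OF _ assms])
  have "rec_nat y (\<lambda>m r. Suc r) x = x + y" for x y :: nat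
    by (induction x) auto
  moreover have "recursive 2 (\<lambda>xs. rec_nat (xs ! 1) (\<lambda>m r. Suc r) (xs ! 0))"
    by (rule recursive_rec_nat2[where a = "\<lambda>y. y" and g = "\<lambda>m r y. Suc r"])
      (intro recursive_Suc recursive_nth, simp)+
  ultimately show "recursive 2 (\<lambda>xs. xs ! 0 + xs ! 1)" by simp
qed

lemma recursive_pred:
  assumes "recursive n a"
  shows "recursive n (\<lambda>xs. a xs - 1)"
proof (rule recursive_compose1[OF _ assms])
  show "recursive 1 (\<lambda>xs. xs ! 0 - 1)"
    \<comment> \<open>The step function returns the counter and discards the recursive
      value.\<close>
    using recursive.primitive_recursion[of 0 "\<lambda>_. 0" "\<lambda>xs. xs ! 0" "\<lambda>xs. xs ! 0 - 1"]
    by (simp add: recursive_const recursive_nth)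
qed

lemma recursive_diff:
  assumes "recursive n a" "recursive n b"
  shows "recursive n (\<lambda>xs. a xs - b xs)"
\<comment> \<open>Primitive recursion runs on the first argument, so the subtrahend comes first: the
  predecessor is iterated that many times.\<close>
proof (rule recursive_compose2[where f = "\<lambda>y x. x - y", OF _ assms(2,1)])
  have "rec_nat y (\<lambda>m r. r - 1) x = y - x" for x y :: nat
    by (induction x) auto
  moreover have "recursive 2 (\<lambda>xs. rec_nat (xs ! 1) (\<lambda>m r. r - 1) (xs ! 0))"
    by (rule recursive_rec_nat2[where a = "\<lambda>y. y" and g = "\<lambda>m r y. r - 1"])
      (intro recursive_pred recursive_nth, simp)+
  ultimately show "recursive 2 (\<lambda>xs. xs ! 1 - xs ! 0)" by simp
qed

lemma recursive_triangle:
  assumes "recursive n a"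
  shows "recursive n (\<lambda>xs. triangle (a xs))"
proof (rule recursive_compose1[OF _ assms])
  show "recursive 1 (\<lambda>xs. triangle (xs ! 0))"
    using recursive.primitive_recursion[of 0 "\<lambda>_. 0" "\<lambda>xs. Suc (xs ! 0 + xs ! 1)"
        "\<lambda>xs. triangle (xs ! 0)"]
    by (simp add: recursive_const recursive_nth recursive_Suc recursive_add add.commute)
qed

lemma recursive_prod_encode:
  "recursive n a \<Longrightarrow> recursive n b \<Longrightarrow> recursive n (\<lambda>xs. prod_encode (a xs, b xs))"
  unfolding prod_encode_def by (simp add: recursive_add recursive_triangle)

section \<open>Unpairing by minimisation\<close>

abbreviation pfst :: "nat \<Rightarrow> nat" where "pfst z \<equiv> fst (prod_decode z)"
abbreviation psnd :: "nat \<Rightarrow> nat" where "psnd z \<equiv> snd (prod_decode z)"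

text \<open>The number of the diagonal of the pairing function on which its argument lies.\<close>

definition diagonal :: "nat \<Rightarrow> nat" where
  "diagonal z = (LEAST w. Suc z - triangle (Suc w) = 0)"

lemma mono_triangle: "mono triangle"
  by (rule mono_iff_le_Suc[THEN iffD2]) simp

text \<open>The code \<open>triangle (m + n) + m\<close> lies at or above
  \<open>triangle (m + n)\<close> and strictly below \<open>triangle (Suc (m + n))\<close>. With
  truncated subtraction, the equation in \<open>diagonal\<close> says that the code is below
  \<open>triangle (Suc w)\<close>.\<close>

lemma diagonal_prod_encode: "diagonal (prod_encode (m, n)) = m + n"
  unfolding diagonal_def
proof (rule Least_equality)
  show "Suc (prod_encode (m, n)) - triangle (Suc (m + n)) = 0"
    by (simp add: prod_encode_def)
next
  fix w
  assume w: "Suc (prod_encode (m, n)) - triangle (Suc w) = 0"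
  show "m + n \<le> w"
  proof (rule ccontr)
    assume "\<not> m + n \<le> w"
    then have "triangle (Suc w) \<le> triangle (m + n)"
      by (intro monoD[OF mono_triangle]) simp
    with w show False by (simp add: prod_encode_def)
  qed
qed

lemma pfst_eq_diagonal: "pfst z = z - triangle (diagonal z)"
  and psnd_eq_diagonal: "psnd z = diagonal z - pfst z"
proof -
  obtain m n where z: "z = prod_encode (m, n)"
    by (metis prod_decode_inverse surj_pair)
  show "pfst z = z - triangle (diagonal z)"
    by (simp add: z diagonal_prod_encode) (simp add: prod_encode_def)
  show "psnd z = diagonal z - pfst z"
    by (simp add: z diagonal_prod_encode)
qed

text \<open>
  From here on a computable function has a single argument, an environment holding the values of
  all variables in nested pairs. Binding a variable amounts to pairing its value with the
  environment, so no arities have to be tracked.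
\<close>

definition computable :: "(nat \<Rightarrow> nat) \<Rightarrow> bool" where
  "computable f \<longleftrightarrow> recursive 1 (\<lambda>xs. f (xs ! 0))"

definition computable_pred :: "(nat \<Rightarrow> bool) \<Rightarrow> bool" where
  "computable_pred P \<longleftrightarrow> computable (\<lambda>e. of_bool (P e))"

named_theorems computable_intros

section \<open>Arithmetic on environments\<close>

lemma computable_compose:
  "computable f \<Longrightarrow> computable a \<Longrightarrow> computable (\<lambda>e. f (a e))"
  unfolding computable_def by (rule recursive_compose1)

lemma computable_id [computable_intros]: "computable (\<lambda>e. e)"
  unfolding computable_def by (rule recursive_nth) simp

lemma computable_const [computable_intros]: "computable (\<lambda>e. c)"
  unfolding computable_def by (rule recursive_const)

lemma computable_Suc [computable_intros]: "computable a \<Longrightarrow> computable (\<lambda>e. Suc (a e))"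
  unfolding computable_def by (rule recursive_Suc)

lemma computable_add [computable_intros]:
  "computable a \<Longrightarrow> computable b \<Longrightarrow> computable (\<lambda>e. a e + b e)"
  unfolding computable_def by (rule recursive_add)

lemma computable_diff [computable_intros]:
  "computable a \<Longrightarrow> computable b \<Longrightarrow> computable (\<lambda>e. a e - b e)"
  unfolding computable_def by (rule recursive_diff)

lemma computable_prod_encode [computable_intros]:
  "computable a \<Longrightarrow> computable b \<Longrightarrow> computable (\<lambda>e. prod_encode (a e, b e))"
  unfolding computable_def by (rule recursive_prod_encode)

lemma computable_diagonal: "computable diagonal"
  unfolding computable_def
proof (rule recursive.minimisation)
  show "recursive (Suc 1) (\<lambda>xs. Suc (xs ! 1) - triangle (Suc (xs ! 0)))"
    by (intro recursive_diff recursive_triangle recursive_Suc recursive_nth) simp_all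
  show "\<exists>y. Suc ((y # xs) ! 1) - triangle (Suc ((y # xs) ! 0)) = 0" for xs
    by (rule exI[of _ "xs ! 0"]) simp
qed (simp add: diagonal_def)

lemma computable_pfst [computable_intros]: "computable a \<Longrightarrow> computable (\<lambda>e. pfst (a e))"
  and computable_psnd [computable_intros]: "computable a \<Longrightarrow> computable (\<lambda>e. psnd (a e))"
proof -
  have "computable (\<lambda>z. triangle (diagonal z))"
    using computable_diagonal unfolding computable_def by (rule recursive_triangle)
  then have *: "computable pfst"
    unfolding pfst_eq_diagonal by (intro computable_intros)
  then have **: "computable psnd"
    unfolding psnd_eq_diagonal by (intro computable_intros computable_diagonal)
  show "computable a \<Longrightarrow> computable (\<lambda>e. pfst (a e))"
    using * by (rule computable_compose)
  show "computable a \<Longrightarrow> computable (\<lambda>e. psnd (a e))"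
    using ** by (rule computable_compose)
qed

text \<open>Counter, previous value and environment reach the step function as one nested pair, so
  its computability is again a goal about a unary function.\<close>

lemma computable_rec_nat [computable_intros]:
  assumes "computable a" "computable n"
    and "computable (\<lambda>z. g (pfst z) (pfst (psnd z)) (psnd (psnd z)))"
  shows "computable (\<lambda>e. rec_nat (a e) (\<lambda>m r. g m r e) (n e))"
proof -
  have "recursive 3
      (\<lambda>xs. (\<lambda>z. g (pfst z) (pfst (psnd z)) (psnd (psnd z)))
        (prod_encode (xs ! 0, prod_encode (xs ! 1, xs ! 2))))"
    using assms(3) unfolding computable_def
    by (rule recursive_compose1) (intro recursive_prod_encode recursive_nth; simp)
  then have "recursive 2 (\<lambda>xs. rec_nat (a (xs ! 1)) (\<lambda>m r. g m r (xs ! 1)) (xs ! 0))"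
    using assms(1) by (intro recursive_rec_nat2) (simp_all add: computable_def)
  then show ?thesis
    unfolding computable_def
    by (rule recursive_compose2[where f = "\<lambda>n e. rec_nat (a e) (\<lambda>m r. g m r e) n"])
      (use assms(2) in \<open>simp_all add: computable_def recursive_nth\<close>)
qed

lemma computable_mult [computable_intros]:
  assumes "computable a" "computable b"
  shows "computable (\<lambda>e. a e * b e)"
proof -
  have "rec_nat 0 (\<lambda>_ r. r + y) x = x * y" for x y :: nat
    by (induction x) auto
  moreover have "computable (\<lambda>e. rec_nat 0 (\<lambda>_ r. r + b e) (a e))"
    \<comment> \<open>Under the binders of the recursion the old environment is
      \<open>psnd (psnd z)\<close>, hence the composition with \<open>b\<close>.\<close>
    by (intro computable_intros assms computable_compose[OF assms(2)])
  ultimately show ?thesis by simp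
qed

lemma computable_power [computable_intros]:
  assumes "computable a" "computable b"
  shows "computable (\<lambda>e. a e ^ b e)"
proof -
  have "rec_nat 1 (\<lambda>_ r. y * r) x = y ^ x" for x y :: nat
    by (induction x) auto
  moreover have "computable (\<lambda>e. rec_nat 1 (\<lambda>_ r. a e * r) (b e))"
    by (intro computable_intros assms computable_compose[OF assms(1)])
  ultimately show ?thesis by simp
qed

section \<open>Connectives, comparisons and bounded quantifiers\<close>

lemma computable_pred_compose:
  "computable_pred P \<Longrightarrow> computable a \<Longrightarrow> computable_pred (\<lambda>e. P (a e))"
  unfolding computable_pred_def by (rule computable_compose)

lemma computable_pred_compose2:
  assumes "computable_pred (\<lambda>z. P (pfst z) (psnd z))" "computable a" "computable b"
  shows "computable_pred (\<lambda>e. P (a e) (b e))"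
  using computable_pred_compose[OF assms(1) computable_prod_encode[OF assms(2,3)]] by simp

lemma computable_pred_compose3:
  assumes "computable_pred (\<lambda>z. P (pfst z) (pfst (psnd z)) (psnd (psnd z)))"
    and "computable a" "computable b" "computable c"
  shows "computable_pred (\<lambda>e. P (a e) (b e) (c e))"
  using computable_pred_compose[OF assms(1) computable_prod_encode[OF assms(2)
        computable_prod_encode[OF assms(3,4)]]] by simp

lemma computable_pred_not [computable_intros]:
  assumes "computable_pred P"
  shows "computable_pred (\<lambda>e. \<not> P e)"
proof -
  have "of_bool (\<not> p) = 1 - (of_bool p :: nat)" for p by simp
  moreover have "computable (\<lambda>e. 1 - of_bool (P e))"
    using assms unfolding computable_pred_def by (intro computable_intros)
  ultimately show ?thesis unfolding computable_pred_def by (simp only:)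
qed

lemma computable_pred_conj [computable_intros]:
  "computable_pred P \<Longrightarrow> computable_pred Q \<Longrightarrow> computable_pred (\<lambda>e. P e \<and> Q e)"
  unfolding computable_pred_def of_bool_conj by (intro computable_intros)

lemma computable_pred_disj [computable_intros]:
  assumes "computable_pred P" "computable_pred Q"
  shows "computable_pred (\<lambda>e. P e \<or> Q e)"
proof -
  have "computable_pred (\<lambda>e. \<not> (\<not> P e \<and> \<not> Q e))"
    by (intro computable_intros assms)
  then show ?thesis by simp
qed

lemma computable_pred_imp [computable_intros]:
  "computable_pred P \<Longrightarrow> computable_pred Q \<Longrightarrow> computable_pred (\<lambda>e. P e \<longrightarrow> Q e)"
  unfolding imp_conv_disj by (intro computable_intros)

lemma computable_pred_iff [computable_intros]:
  "computable_pred P \<Longrightarrow> computable_pred Q \<Longrightarrow> computable_pred (\<lambda>e. P e \<longleftrightarrow> Q e)"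
  unfolding iff_conv_conj_imp by (intro computable_intros)

lemma computable_pred_if [computable_intros]:
  "computable_pred P \<Longrightarrow> computable_pred Q \<Longrightarrow> computable_pred R \<Longrightarrow>
    computable_pred (\<lambda>e. if P e then Q e else R e)"
  unfolding if_bool_eq_conj by (intro computable_intros)

lemma computable_pred_eq [computable_intros]:
  assumes "computable a" "computable b"
  shows "computable_pred (\<lambda>e. a e = b e)"
proof -
  \<comment> \<open>Both truncated differences vanish exactly when the numbers agree.\<close>
  have "of_bool (x = y) = 1 - ((x - y) + (y - x))" for x y :: nat by auto
  moreover have "computable (\<lambda>e. 1 - ((a e - b e) + (b e - a e)))"
    by (intro computable_intros assms)
  ultimately show ?thesis unfolding computable_pred_def by (simp only:)
qed

lemma computable_pred_less [computable_intros]: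
  assumes "computable a" "computable b"
  shows "computable_pred (\<lambda>e. a e < b e)"
proof -
  have "computable_pred (\<lambda>e. \<not> b e - a e = 0)"
    by (intro computable_intros assms)
  then show ?thesis by (simp add: not_le)
qed

lemma computable_Least:
  assumes P: "computable_pred (\<lambda>z. P (pfst z) (psnd z))" and ex: "\<And>e. \<exists>y. P y e"
  shows "computable (\<lambda>e. LEAST y. P y e)"
  unfolding computable_def
proof (rule recursive.minimisation)
  \<comment> \<open>Minimisation looks for a zero, so the search runs on the negated
    predicate.\<close>
  have "computable (\<lambda>z. of_bool (\<not> P (pfst z) (psnd z)))"
    using computable_pred_not[OF P] by (simp add: computable_pred_def)
  then have "recursive (Suc 1) (\<lambda>xs. (\<lambda>z. of_bool (\<not> P (pfst z) (psnd z)))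
      (prod_encode (xs ! 0, xs ! 1)))"
    unfolding computable_def
    by (rule recursive_compose1) (intro recursive_prod_encode recursive_nth; simp)
  then show "recursive (Suc 1) (\<lambda>xs. of_bool (\<not> P (xs ! 0) (xs ! 1)))"
    by simp
qed (use ex in simp_all)

text \<open>The disjunct \<open>y = b e\<close> makes the search total; a witness below the bound
  exists iff the search stops strictly before it.\<close>

lemma computable_pred_ex [computable_intros]:
  assumes b: "computable b" and P: "computable_pred (\<lambda>z. P (pfst z) (psnd z))"
  shows "computable_pred (\<lambda>e. \<exists>y<b e. P y e)"
proof -
  have "(\<exists>y<b e. P y e) \<longleftrightarrow> (LEAST y. P y e \<or> y = b e) < b e" for e
    by (smt (verit, del_insts) LeastI Least_le le_less_trans order_less_irrefl)
  moreover have "computable (\<lambda>e. LEAST y. P y e \<or> y = b e)"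
    by (rule computable_Least) (intro computable_intros P computable_compose[OF b], blast)
  then have "computable_pred (\<lambda>e. (LEAST y. P y e \<or> y = b e) < b e)"
    by (intro computable_intros b)
  ultimately show ?thesis by simp
qed

lemma computable_pred_all [computable_intros]:
  assumes "computable b" "computable_pred (\<lambda>z. P (pfst z) (psnd z))"
  shows "computable_pred (\<lambda>e. \<forall>y<b e. P y e)"
proof -
  have "computable_pred (\<lambda>e. \<not> (\<exists>y<b e. \<not> P y e))"
    by (intro computable_intros assms)
  then show ?thesis by simp
qed

lemma computable_div [computable_intros]:
  assumes "computable a" "computable b"
  shows "computable (\<lambda>e. a e div b e)"
proof -
  \<comment> \<open>The quotient is the first \<open>q\<close> whose successor multiple exceeds
    \<open>x\<close>. For \<open>y = 0\<close> the extra disjunct stops the search at 0, which is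
    the value of \<open>x div 0\<close>.\<close>
  have "(LEAST q. y = 0 \<or> x < y * Suc q) = x div y" for x y :: nat
  proof (cases "y = 0")
    case False
    then have "x < y * Suc q \<longleftrightarrow> x div y \<le> q" for q
      by (simp add: less_mult_imp_div_less div_less_iff_less_mult mult.commute flip: less_Suc_eq_le)
    with False show ?thesis by (auto intro: Least_equality)
  qed (simp add: Least_equality)
  moreover have "computable (\<lambda>e. LEAST q. b e = 0 \<or> a e < b e * Suc q)"
  proof (rule computable_Least)
    show "\<exists>q. b e = 0 \<or> a e < b e * Suc q" for e
      by (rule exI[of _ "a e"]) (cases "b e"; simp)
  qed (intro computable_intros computable_compose[OF assms(1)] computable_compose[OF assms(2)])
  ultimately show ?thesis by simp
qed

text \<open>A bit is tested by the parity of a quotient, and parity is itself expressible by halving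
  and doubling.\<close>

lemma computable_pred_mem_set_decode [computable_intros]:
  assumes "computable a" "computable b"
  shows "computable_pred (\<lambda>e. a e \<in> set_decode (b e))"
proof -
  have "odd x \<longleftrightarrow> x \<noteq> 2 * (x div 2)" for x :: nat by presburger
  then have "a e \<in> set_decode (b e) \<longleftrightarrow> b e div 2 ^ a e \<noteq> 2 * (b e div 2 ^ a e div 2)" for e
    unfolding set_decode_def mem_Collect_eq .
  moreover have "computable_pred (\<lambda>e. b e div 2 ^ a e \<noteq> 2 * (b e div 2 ^ a e div 2))"
    by (intro computable_intros assms)
  ultimately show ?thesis by (simp only:)
qed

section \<open>Lists as numbers\<close>

text \<open>A nonempty list is coded as the successor of the pair of its head and its coded tail, so
  each iteration strips one entry.\<close>

definition ldrop :: "nat \<Rightarrow> nat \<Rightarrow> nat" where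
  "ldrop l i = rec_nat l (\<lambda>_ r. psnd (r - 1)) i"

definition lnth :: "nat \<Rightarrow> nat \<Rightarrow> nat" where
  "lnth l i = pfst (ldrop l i - 1)"

definition llen :: "nat \<Rightarrow> nat" where
  "llen l = (LEAST i. ldrop l i = 0)"

text \<open>The recursion that codes \<open>n\<close> copies of \<open>m\<close>, started at 1
  instead of 0. By monotonicity of pairing it strictly exceeds the code of every list of length
  \<open>n\<close> with entries at most \<open>m\<close>, and so bounds quantifiers over such
  lists.\<close>

definition list_bound :: "nat \<Rightarrow> nat \<Rightarrow> nat" where
  "list_bound n m = rec_nat 1 (\<lambda>_ r. Suc (prod_encode (m, r))) n"

lemma ldrop_list_encode: "ldrop (list_encode xs) i = list_encode (drop i xs)"
proof (induction i)
  case (Suc i)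
  have "psnd (list_encode ys - 1) = list_encode (tl ys)" for ys
  proof (cases ys)
    case Nil
    \<comment> \<open>Dropping from the empty list must stay at its code 0: \<open>0 - 1\<close> is
      0, which unpairs to zeros.\<close>
    have "prod_decode 0 = (0, 0)"
      by (simp add: prod_decode_def prod_decode_aux.simps)
    with Nil show ?thesis by simp
  qed simp
  with Suc show ?case
    by (simp add: ldrop_def drop_Suc tl_drop)
qed (simp add: ldrop_def)

lemma lnth_list_encode: "i < length xs \<Longrightarrow> lnth (list_encode xs) i = xs ! i"
  by (simp add: lnth_def ldrop_list_encode flip: Cons_nth_drop_Suc)

lemma llen_list_encode: "llen (list_encode xs) = length xs"
proof -
  have "list_encode ys = 0 \<longleftrightarrow> ys = []" for ys
    by (cases ys) simp_all
  then show ?thesis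
    unfolding llen_def ldrop_list_encode by (auto intro: Least_equality)
qed

lemma prod_encode_mono: "a \<le> c \<Longrightarrow> b \<le> d \<Longrightarrow> prod_encode (a, b) \<le> prod_encode (c, d)"
  by (simp add: prod_encode_def add_mono monoD[OF mono_triangle])

lemma list_encode_less_bound: "\<forall>x\<in>set xs. x \<le> m \<Longrightarrow> list_encode xs < list_bound (length xs) m"
proof (induction xs)
  case (Cons x xs)
  have "prod_encode (x, list_encode xs) < prod_encode (x, Suc (list_encode xs))"
    by (simp add: prod_encode_def)
  also have "\<dots> \<le> prod_encode (m, list_bound (length xs) m)"
    using Cons by (intro prod_encode_mono) simp_all
  finally show ?case by (simp add: list_bound_def)
qed (simp add: list_bound_def)

lemma less_list_encode: "x \<in> set xs \<Longrightarrow> x < list_encode xs"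
proof (induction xs)
  case (Cons y xs)
  then show ?case
    using le_prod_encode_1[of y "list_encode xs"] le_prod_encode_2[of "list_encode xs" y] by auto
qed simp

lemma computable_ldrop [computable_intros]:
  "computable a \<Longrightarrow> computable b \<Longrightarrow> computable (\<lambda>e. ldrop (a e) (b e))"
  unfolding ldrop_def by (intro computable_intros)

lemma computable_lnth [computable_intros]:
  "computable a \<Longrightarrow> computable b \<Longrightarrow> computable (\<lambda>e. lnth (a e) (b e))"
  unfolding lnth_def by (intro computable_intros)

lemma computable_llen [computable_intros]:
  assumes "computable a"
  shows "computable (\<lambda>e. llen (a e))"
proof (rule computable_compose[OF _ assms])
  show "computable llen"
    unfolding llen_def
  proof (rule computable_Least)
    \<comment> \<open>Every number codes a list, so the search for its end always halts.\<close>
    show "\<exists>i. ldrop l i = 0" for l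
      using ldrop_list_encode[of "list_decode l" "length (list_decode l)"] by auto
  qed (intro computable_intros)
qed

lemma computable_list_bound [computable_intros]:
  assumes "computable a" "computable b"
  shows "computable (\<lambda>e. list_bound (a e) (b e))"
  unfolding list_bound_def by (intro computable_intros assms computable_compose[OF assms(2)])

section \<open>Initial action sets\<close>

definition initials :: "language \<Rightarrow> tm \<Rightarrow> action set" where
  "initials G p = {a. \<exists>q. step G p a q}"

text \<open>The operation on action sets that \<open>f\<close> induces. Each argument is represented
  by its initial actions alone, and the targets of premises are forgotten.\<close>

definition enabled :: "language \<Rightarrow> opsym \<Rightarrow> action set list \<Rightarrow> action set" where
  "enabled G f As = {c. \<exists>r\<in>set (rules G). oper r = f \<and> label r = c \<and>
    length (sources r) = length As \<and>
    (\<forall>i<length As.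
      (\<forall>(x, a, y)\<in>set (pos r). x = sources r ! i \<longrightarrow> a \<in> As ! i) \<and>
      (\<forall>(x, b)\<in>set (neg r). x = sources r ! i \<longrightarrow> b \<notin> As ! i))}"

text \<open>Sources are distinct from each other and from premise targets, so \<open>ts\<close>
  fixes \<open>\<sigma>\<close> on the sources while targets remain free. Each target belongs to a
  single premise, so a successor can be chosen for it without conflict.\<close>

lemma rule_matching_subst:
  assumes r: "gsos_rule G r" and len: "length (sources r) = length ts"
    and can: "\<And>i x a y. i < length ts \<Longrightarrow> (x, a, y) \<in> set (pos r) \<Longrightarrow> x = sources r ! i \<Longrightarrow>
      \<exists>q. step G (ts ! i) a q"
  shows "\<exists>\<sigma>. map \<sigma> (sources r) = ts \<and> (\<forall>(x, a, y)\<in>set (pos r). step G (\<sigma> x) a (\<sigma> y))"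
proof -
  define src where "src = (\<lambda>x. the (map_of (zip (sources r) ts) x))"
  define \<sigma> where "\<sigma> z = (if z \<in> set (sources r) then src z
    else SOME q. \<exists>x a. (x, a, z) \<in> set (pos r) \<and> step G (src x) a q)" for z
  have dist: "distinct (sources r)" "distinct (map (\<lambda>(x, a, y). y) (pos r))"
    using r unfolding gsos_rule_def Let_def distinct_append by blast+
  have disj: "y \<notin> set (sources r)" if "(x, a, y) \<in> set (pos r)" for x a y
  proof -
    have "y \<in> set (map (\<lambda>(x, a, y). y) (pos r))"
      using that by (simp add: rev_image_eqI)
    then show ?thesis
      using r unfolding gsos_rule_def Let_def distinct_append by blast
  qed
  from dist(1) have src: "src (sources r ! i) = ts ! i" if "i < length ts" for i
    using that len by (simp add: src_def map_of_zip_nth)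
  then have \<sigma>: "\<sigma> (sources r ! i) = ts ! i" if "i < length ts" for i
    using that len by (simp add: \<sigma>_def)
  show ?thesis
  proof (intro exI conjI)
    show "map \<sigma> (sources r) = ts"
      using \<sigma> len by (auto intro: nth_equalityI)
    have "step G (\<sigma> x) a (\<sigma> y)" if xay: "(x, a, y) \<in> set (pos r)" for x a y
    proof -
      \<comment> \<open>Distinctness of the targets: \<open>y\<close> determines its premise, so the
        transition selected by \<open>SOME\<close> is the one that this premise asks for.\<close>
      have uniq: "x' = x \<and> a' = a" if "(x', a', y) \<in> set (pos r)" for x' a'
        using dist(2) that xay by (auto simp: distinct_map inj_on_def)
      have "x \<in> set (sources r)"
        using gsos_rule_premises(1)[OF r xay] .
      then obtain i where i: "i < length ts" "x = sources r ! i"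
        using len by (auto simp: in_set_conv_nth)
      then have "\<exists>q. step G (src x) a q"
        using can[OF i(1) xay i(2)] src by simp
      then have "\<exists>q x a. (x, a, y) \<in> set (pos r) \<and> step G (src x) a q"
        using xay by blast
      then have "\<exists>x a. (x, a, y) \<in> set (pos r) \<and> step G (src x) a (\<sigma> y)"
        unfolding \<sigma>_def if_not_P[OF disj[OF xay]] by (rule someI_ex)
      then have "step G (src x) a (\<sigma> y)"
        using uniq by blast
      then show ?thesis
        using i \<sigma> src by simp
    qed
    then show "\<forall>(x, a, y)\<in>set (pos r). step G (\<sigma> x) a (\<sigma> y)"
      by blast
  qed
qed

text \<open>A firing rule shows which premises the initial actions of the arguments meet.
  Conversely, \<open>rule_matching_subst\<close> satisfies the positive premises, and the negative
  ones depend only on \<open>\<sigma>\<close> at the sources, which is given by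
  \<open>ts\<close>.\<close>

lemma initials_Op:
  assumes G: "gsos_language G"
  shows "initials G (Op f ts) = enabled G f (map (initials G) ts)"
proof (intro set_eqI iffI)
  fix c
  assume "c \<in> initials G (Op f ts)"
  then obtain r \<sigma> where r: "r \<in> set (rules G)" "oper r = f" "map \<sigma> (sources r) = ts" "label r = c"
    and p: "\<And>x a y. (x, a, y) \<in> set (pos r) \<Longrightarrow> step G (\<sigma> x) a (\<sigma> y)"
    and n: "\<And>x b. (x, b) \<in> set (neg r) \<Longrightarrow> \<not> (\<exists>p. step G (\<sigma> x) b p)"
    by (auto simp: initials_def)
  from p n have "(\<forall>(x, a, y)\<in>set (pos r). x = sources r ! i \<longrightarrow> a \<in> initials G (ts ! i)) \<and>
      (\<forall>(x, b)\<in>set (neg r). x = sources r ! i \<longrightarrow> b \<notin> initials G (ts ! i))"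
    if "i < length ts" for i
    using that r(3) by (fastforce simp: initials_def)
  with r show "c \<in> enabled G f (map (initials G) ts)"
    unfolding enabled_def mem_Collect_eq by (intro bexI[of _ r]) auto
next
  fix c
  assume "c \<in> enabled G f (map (initials G) ts)"
  then obtain r where r: "r \<in> set (rules G)" "oper r = f" "label r = c"
      "length (sources r) = length ts"
    and p: "\<And>i x a y. i < length ts \<Longrightarrow> (x, a, y) \<in> set (pos r) \<Longrightarrow> x = sources r ! i \<Longrightarrow>
      \<exists>q. step G (ts ! i) a q"
    and n: "\<And>i x b. i < length ts \<Longrightarrow> (x, b) \<in> set (neg r) \<Longrightarrow> x = sources r ! i \<Longrightarrow>
      \<not> (\<exists>q. step G (ts ! i) b q)"
    by (fastforce simp: enabled_def initials_def)
  have gsos: "gsos_rule G r"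
    using G r(1) by (simp add: gsos_language_def)
  have "\<exists>\<sigma>. map \<sigma> (sources r) = ts \<and> (\<forall>(x, a, y)\<in>set (pos r). step G (\<sigma> x) a (\<sigma> y))"
    using gsos r(4) by (rule rule_matching_subst) (rule p)
  then obtain \<sigma> where \<sigma>: "map \<sigma> (sources r) = ts"
    and pos: "\<And>x a y. (x, a, y) \<in> set (pos r) \<Longrightarrow> step G (\<sigma> x) a (\<sigma> y)"
    by blast
  have neg: "\<not> (\<exists>q. step G (\<sigma> x) b q)" if xb: "(x, b) \<in> set (neg r)" for x b
  proof -
    have "x \<in> set (sources r)"
      using gsos_rule_premises(2)[OF gsos xb] .
    then obtain i where i: "i < length ts" "x = sources r ! i"
      using r(4) by (auto simp: in_set_conv_nth)
    then have "\<sigma> x = ts ! i"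
      using \<sigma> r(4) nth_map by metis
    with n[OF i(1) xb i(2)] show ?thesis by simp
  qed
  have "step G (Op f ts) c (subst \<sigma> (target r))"
    unfolding step.simps
    by (rule exI[of _ r], rule exI[of _ \<sigma>]) (intro conjI allI impI r gsos \<sigma> pos neg refl)
  then show "c \<in> initials G (Op f ts)"
    by (auto simp: initials_def)
qed

lemma closed_term_Op:
  "closed_term G (Op f ts) \<longleftrightarrow>
    (f, length ts) \<in> set (signature G) \<and> (\<forall>t\<in>set ts. closed_term G t)"
  by (auto simp: closed_term_def)

lemma closed_term_subst:
  "term_over G t \<Longrightarrow> (\<And>x. x \<in> vars t \<Longrightarrow> closed_term G (\<sigma> x)) \<Longrightarrow> closed_term G (subst \<sigma> t)"
  by (induction t) (auto simp: closed_term_Op)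

text \<open>A variable of the target is a source, instantiated by a closed argument, or a premise
  target, closed by the induction hypothesis for the argument that the premise tests.\<close>

lemma closed_term_step:
  "step G p a q \<Longrightarrow> closed_term G p \<Longrightarrow> closed_term G q"
proof (induction p arbitrary: a q)
  case (Op f ts)
  then obtain r \<sigma> where r: "gsos_rule G r" "map \<sigma> (sources r) = ts" "subst \<sigma> (target r) = q"
    and p: "\<And>x a y. (x, a, y) \<in> set (pos r) \<Longrightarrow> step G (\<sigma> x) a (\<sigma> y)"
    by auto
  have src: "closed_term G (\<sigma> x)" if "x \<in> set (sources r)" for x
    using that r(2) Op.prems(2) by (auto simp: closed_term_Op)
  have "closed_term G (\<sigma> y)" if "(x, a, y) \<in> set (pos r)" for x a y
  proof -
    have "x \<in> set (sources r)"
      using gsos_rule_premises(1)[OF r(1) that] .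
    with src r(2) have "\<sigma> x \<in> set ts" "closed_term G (\<sigma> x)" by auto
    then show ?thesis
      using Op.IH p[OF that] by blast
  qed
  with src r(1,3) show ?case
    by (auto simp: gsos_rule_def Let_def intro!: closed_term_subst)
qed simp

primrec holds :: "(var \<Rightarrow> action set) \<Rightarrow> form \<Rightarrow> bool" where
  "holds \<rho> TrueF \<longleftrightarrow> True"
| "holds \<rho> (CanF x a) \<longleftrightarrow> a \<in> \<rho> x"
| "holds \<rho> (NotF F) \<longleftrightarrow> \<not> holds \<rho> F"
| "holds \<rho> (AndF F F') \<longleftrightarrow> holds \<rho> F \<and> holds \<rho> F'"

text \<open>The closedness demanded of the successor in \<open>sat\<close> is automatic from a
  closed source, so only initial actions matter.\<close>

lemma sat_iff_holds: "model G \<sigma> \<Longrightarrow> sat G \<sigma> F \<longleftrightarrow> holds (\<lambda>x. initials G (\<sigma> x)) F"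
proof (induction F)
  case (CanF x a)
  then have "closed_term G p" if "step G (\<sigma> x) a p" for p
    using closed_term_step[OF that] by (simp add: model_def)
  then show ?case by (auto simp: initials_def)
qed simp_all

section \<open>Families of action sets closed under the operations\<close>

definition op_closed :: "language \<Rightarrow> action set set \<Rightarrow> bool" where
  "op_closed G S \<longleftrightarrow> (\<forall>(f, n)\<in>set (signature G). \<forall>As. length As = n \<longrightarrow> set As \<subseteq> S \<longrightarrow>
    enabled G f As \<in> S)"

text \<open>Structural induction through \<open>initials_Op\<close>; constants are operations of
  arity 0 and need no separate base case.\<close>

lemma initials_in_op_closed:
  "gsos_language G \<Longrightarrow> op_closed G S \<Longrightarrow> closed_term G p \<Longrightarrow> initials G p \<in> S"
proof (induction p)
  case (Op f ts)
  then have "set (map (initials G) ts) \<subseteq> S" "(f, length ts) \<in> set (signature G)"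
    by (auto simp: closed_term_Op)
  then have "enabled G f (map (initials G) ts) \<in> S"
    using Op.prems(2) unfolding op_closed_def by fastforce
  then show ?case
    by (simp add: initials_Op[OF Op.prems(1)])
qed (simp add: closed_term_def)

text \<open>Closed terms realising the arguments are combined by \<open>f\<close> into a closed term
  realising the result.\<close>

lemma op_closed_initials:
  assumes "gsos_language G"
  shows "op_closed G (initials G ` Collect (closed_term G))"
  unfolding op_closed_def
proof (clarify)
  fix f As
  assume f: "(f, length As) \<in> set (signature G)"
    and As: "set As \<subseteq> initials G ` Collect (closed_term G)"
  then have "As \<in> lists (initials G ` Collect (closed_term G))" by auto
  then obtain ts where "As = map (initials G) ts" "ts \<in> lists (Collect (closed_term G))"
    unfolding lists_image by blast
  with f show "enabled G f As \<in> initials G ` Collect (closed_term G)"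
    using initials_Op[OF assms] by (auto simp: closed_term_Op intro!: image_eqI[of _ _ "Op f ts"])
qed

text \<open>
  The realisable initial sets are the least family closed under the operations, and passing to a
  smaller family only weakens the condition on valuations.
\<close>

lemma entails_iff_op_closed:
  assumes G: "gsos_language G"
  shows "entails G F F' \<longleftrightarrow> (\<exists>S \<subseteq> Pow (label ` set (rules G)). op_closed G S \<and>
    (\<forall>\<rho>. range \<rho> \<subseteq> S \<longrightarrow> holds \<rho> F \<longrightarrow> holds \<rho> F'))"
proof
  assume *: "entails G F F'"
  let ?S = "initials G ` Collect (closed_term G)"
  \<comment> \<open>Initial actions are labels of rules, which confines the family to finitely many
    finite sets.\<close>
  have "initials G p \<subseteq> label ` set (rules G)" for p
    by (cases p) (auto simp: initials_def)
  moreover have "holds \<rho> F'" if \<rho>: "range \<rho> \<subseteq> ?S" "holds \<rho> F" for \<rho>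
  proof -
    have "\<forall>x. \<exists>p. closed_term G p \<and> \<rho> x = initials G p"
      using \<rho>(1) by auto
    then obtain \<sigma> where \<sigma>: "\<forall>x. closed_term G (\<sigma> x) \<and> \<rho> x = initials G (\<sigma> x)"
      by metis
    then have "model G \<sigma>" "\<rho> = (\<lambda>x. initials G (\<sigma> x))"
      by (auto simp: model_def)
    with * \<rho>(2) show ?thesis
      by (simp add: entails_def flip: sat_iff_holds)
  qed
  ultimately show "\<exists>S \<subseteq> Pow (label ` set (rules G)). op_closed G S \<and>
      (\<forall>\<rho>. range \<rho> \<subseteq> S \<longrightarrow> holds \<rho> F \<longrightarrow> holds \<rho> F')"
    using op_closed_initials[OF G] by (intro exI[of _ ?S]) auto
next
  assume "\<exists>S \<subseteq> Pow (label ` set (rules G)). op_closed G S \<and>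
    (\<forall>\<rho>. range \<rho> \<subseteq> S \<longrightarrow> holds \<rho> F \<longrightarrow> holds \<rho> F')"
  then obtain S where S: "op_closed G S"
    and *: "\<And>\<rho>. range \<rho> \<subseteq> S \<Longrightarrow> holds \<rho> F \<Longrightarrow> holds \<rho> F'"
    by blast
  show "entails G F F'"
    unfolding entails_def
  proof (intro allI impI)
    fix \<sigma>
    assume \<sigma>: "model G \<sigma>" and "sat G \<sigma> F"
    moreover have "range (\<lambda>x. initials G (\<sigma> x)) \<subseteq> S"
      using \<sigma> initials_in_op_closed[OF G S] by (auto simp: model_def)
    ultimately show "sat G \<sigma> F'"
      using * by (simp add: sat_iff_holds)
  qed
qed

section \<open>The decision procedure\<close>

lemma ex_lnth_list_encode:
  "(\<exists>j<llen (list_encode (map h xs)). P (lnth (list_encode (map h xs)) j)) \<longleftrightarrow> (\<exists>x\<in>set xs. P (h x))"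
proof -
  have "(\<exists>j<llen (list_encode (map h xs)). P (lnth (list_encode (map h xs)) j)) \<longleftrightarrow>
      (\<exists>j<length xs. P (h (xs ! j)))"
    unfolding llen_list_encode by (auto simp: lnth_list_encode)
  also have "\<dots> \<longleftrightarrow> (\<exists>x\<in>set xs. P (h x))"
    unfolding Bex_def in_set_conv_nth by blast
  finally show ?thesis .
qed

lemma all_lnth_list_encode:
  "(\<forall>j<llen (list_encode (map h xs)). P (lnth (list_encode (map h xs)) j)) \<longleftrightarrow> (\<forall>x\<in>set xs. P (h x))"
  using ex_lnth_list_encode[of h xs "\<lambda>x. \<not> P x"] by blast

text \<open>The bits below \<open>n\<close> sum to less than \<open>2 ^ n\<close>, while a bit at
  position \<open>a\<close> forces \<open>2 ^ a \<le> B\<close>. Quantifiers over sets of small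
  numbers thus become bounded.\<close>

lemma set_decode_subset_iff: "set_decode B \<subseteq> {..<n} \<longleftrightarrow> B < 2 ^ n"
proof
  have less: "set_encode {..<n} < 2 ^ n"
    by (induction n) (simp_all add: lessThan_Suc)
  assume "set_decode B \<subseteq> {..<n}"
  then have "B \<le> set_encode {..<n}"
    by (intro subset_decode_imp_le) simp
  with less show "B < 2 ^ n" by simp
next
  assume B: "B < 2 ^ n"
  show "set_decode B \<subseteq> {..<n}"
  proof
    fix a
    assume "a \<in> set_decode B"
    then have "\<not> B < 2 ^ a"
      by (auto simp: set_decode_def)
    with B have "(2::nat) ^ a < 2 ^ n" by linarith
    then show "a \<in> {..<n}" by simp
  qed
qed

section \<open>Rules and closed families in coded form\<close>

text \<open>Positions 1, 2 and 3 of a rule code hold the sources, the positive and the negative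
  premises; \<open>l\<close> lists the masks of the argument sets.\<close>

definition premises_code :: "nat \<Rightarrow> nat \<Rightarrow> bool" where
  "premises_code r l \<longleftrightarrow> llen (lnth r 1) = llen l \<and> (\<forall>i<llen l.
    (\<forall>k<llen (lnth r 2). pfst (lnth (lnth r 2) k) = lnth (lnth r 1) i \<longrightarrow>
      pfst (psnd (lnth (lnth r 2) k)) \<in> set_decode (lnth l i)) \<and>
    (\<forall>k<llen (lnth r 3). pfst (lnth (lnth r 3) k) = lnth (lnth r 1) i \<longrightarrow>
      psnd (lnth (lnth r 3) k) \<notin> set_decode (lnth l i)))"

definition enabled_code :: "nat \<Rightarrow> nat \<Rightarrow> nat \<Rightarrow> nat \<Rightarrow> bool" where
  "enabled_code R f l c \<longleftrightarrow> (\<exists>j<llen R.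
    lnth (lnth R j) 0 = f \<and> lnth (lnth R j) 4 = c \<and> premises_code (lnth R j) l)"

lemma lnth_rule_code:
  "lnth (rule_code r) 0 = oper r"
  "lnth (rule_code r) 1 = list_encode (sources r)"
  "lnth (rule_code r) 2 =
    list_encode (map (\<lambda>(x, a, y). prod_encode (x, prod_encode (a, y))) (pos r))"
  "lnth (rule_code r) 3 = list_encode (map prod_encode (neg r))"
  "lnth (rule_code r) 4 = label r"
  unfolding rule_code_def by (simp_all add: lnth_list_encode del: list_encode.simps)

lemma premises_code_correct:
  "premises_code (rule_code r) (list_encode xs) \<longleftrightarrow> length (sources r) = length xs \<and>
    (\<forall>i<length xs.
      (\<forall>(x, a, y)\<in>set (pos r). x = sources r ! i \<longrightarrow> a \<in> set_decode (xs ! i)) \<and>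
      (\<forall>(x, b)\<in>set (neg r). x = sources r ! i \<longrightarrow> b \<notin> set_decode (xs ! i)))"
  unfolding premises_code_def lnth_rule_code
    all_lnth_list_encode[where P = "\<lambda>v. pfst v = _ \<longrightarrow> pfst (psnd v) \<in> _"]
    all_lnth_list_encode[where P = "\<lambda>v. pfst v = _ \<longrightarrow> psnd v \<notin> _"]
  unfolding llen_list_encode
  by (simp add: lnth_list_encode case_prod_beta cong: conj_cong all_cong)

lemma enabled_code_correct:
  "enabled_code (list_encode (map rule_code (rules G))) f (list_encode xs) c \<longleftrightarrow>
    c \<in> enabled G f (map set_decode xs)"
  unfolding enabled_code_def
    ex_lnth_list_encode[where P = "\<lambda>r. lnth r 0 = f \<and> lnth r 4 = c \<and> premises_code r _"]
  by (simp add: enabled_def lnth_rule_code premises_code_correct cong: conj_cong)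

text \<open>The language code \<open>g\<close> doubles as a bound: all labels lie below it, so label
  sets have masks below \<open>2 ^ g\<close> and are compared on the bits below \<open>g\<close>.
  The family \<open>s\<close> is a mask of masks.\<close>

definition op_closed_code :: "nat \<Rightarrow> nat \<Rightarrow> bool" where
  "op_closed_code g s \<longleftrightarrow> (\<forall>k<llen (lnth g 1).
    \<forall>l<list_bound (psnd (lnth (lnth g 1) k)) (2 ^ g).
      llen l = psnd (lnth (lnth g 1) k) \<and> (\<forall>i<llen l. lnth l i \<in> set_decode s) \<longrightarrow>
      (\<exists>B<2 ^ g. B \<in> set_decode s \<and>
        (\<forall>c<g. c \<in> set_decode B \<longleftrightarrow> enabled_code (lnth g 2) (pfst (lnth (lnth g 1) k)) l c)))"

lemma lnth_language_code:
  "lnth (language_code G) 1 = list_encode (map prod_encode (signature G))"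
  "lnth (language_code G) 2 = list_encode (map rule_code (rules G))"
  unfolding language_code_def by (simp_all add: lnth_list_encode del: list_encode.simps)

lemma label_less_language_code:
  assumes "r \<in> set (rules G)"
  shows "label r < language_code G"
proof -
  have "label r < rule_code r"
    unfolding rule_code_def by (rule less_list_encode) simp
  also have "rule_code r < list_encode (map rule_code (rules G))"
    by (rule less_list_encode) (use assms in simp)
  also have "\<dots> < language_code G"
    unfolding language_code_def by (rule less_list_encode) simp
  finally show ?thesis .
qed

text \<open>Members of \<open>set_decode s\<close> are below \<open>m\<close>, so the bound misses
  no list over them; conversely every number is the code of some list.\<close>

lemma all_list_code:
  assumes s: "s < 2 ^ m"
  shows "(\<forall>l<list_bound n m. llen l = n \<and> (\<forall>i<llen l. lnth l i \<in> set_decode s) \<longrightarrow> P l) \<longleftrightarrow>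
    (\<forall>xs. length xs = n \<longrightarrow> set xs \<subseteq> set_decode s \<longrightarrow> P (list_encode xs))"
proof -
  have elems: "(\<forall>i<llen (list_encode xs). lnth (list_encode xs) i \<in> set_decode s) \<longleftrightarrow>
      set xs \<subseteq> set_decode s" for xs
    unfolding llen_list_encode subset_iff in_set_conv_nth by (auto simp: lnth_list_encode)
  have bound: "list_encode xs < list_bound (length xs) m" if "set xs \<subseteq> set_decode s" for xs
    using that set_decode_subset_iff[of s m] s
    by (intro list_encode_less_bound) (auto dest!: subsetD)
  show ?thesis
  proof safe
    fix xs :: "nat list"
    assume "\<forall>l<list_bound (length xs) m. llen l = length xs \<and>
        (\<forall>i<llen l. lnth l i \<in> set_decode s) \<longrightarrow> P l"
      and "set xs \<subseteq> set_decode s"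
    then show "P (list_encode xs)"
      using bound[of xs] elems[of xs] llen_list_encode[of xs] by blast
  next
    fix l
    assume *: "\<forall>xs. length xs = llen l \<longrightarrow> set xs \<subseteq> set_decode s \<longrightarrow> P (list_encode xs)"
      and l: "\<forall>i<llen l. lnth l i \<in> set_decode s"
    have "P (list_encode (list_decode l))"
      using *[rule_format, of "list_decode l"] l elems[of "list_decode l"]
        llen_list_encode[of "list_decode l"] by simp
    then show "P l" by simp
  qed
qed

lemma op_closed_code_correct:
  assumes s: "s < 2 ^ 2 ^ language_code G"
  shows "op_closed_code (language_code G) s \<longleftrightarrow> op_closed G (set_decode ` set_decode s)"
proof -
  let ?g = "language_code G"
  \<comment> \<open>Both \<open>E\<close> and the sets in the family contain only numbers below
    \<open>?g\<close>, so agreement on these bits is equality.\<close>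
  have witness: "(\<exists>B<2 ^ ?g. B \<in> set_decode s \<and> (\<forall>c<?g. c \<in> set_decode B \<longleftrightarrow> c \<in> E)) \<longleftrightarrow>
      E \<in> set_decode ` set_decode s" if "E \<subseteq> {..<?g}" for E
  proof -
    have less: "B < 2 ^ ?g" if "B \<in> set_decode s" for B
      using that s set_decode_subset_iff[of s "2 ^ ?g"] by auto
    moreover have "(\<forall>c<?g. c \<in> set_decode B \<longleftrightarrow> c \<in> E) \<longleftrightarrow> E = set_decode B"
      if "B \<in> set_decode s" for B
      using less[OF that] \<open>E \<subseteq> {..<?g}\<close> set_decode_subset_iff[of B ?g] by auto
    ultimately show ?thesis by blast
  qed
  have "enabled G f As \<subseteq> {..<?g}" for f As
    using label_less_language_code by (auto simp: enabled_def)
  note witness = witness[OF this]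
  have "op_closed_code ?g s \<longleftrightarrow> (\<forall>(f, n)\<in>set (signature G). \<forall>xs. length xs = n \<longrightarrow>
      set xs \<subseteq> set_decode s \<longrightarrow> enabled G f (map set_decode xs) \<in> set_decode ` set_decode s)"
    unfolding op_closed_code_def lnth_language_code all_list_code[OF s] enabled_code_correct
      witness
      all_lnth_list_encode[where P = "\<lambda>v. \<forall>xs. length xs = psnd v \<longrightarrow> set xs \<subseteq> set_decode s \<longrightarrow>
        enabled G (pfst v) (map set_decode xs) \<in> set_decode ` set_decode s"]
    by (simp add: case_prod_beta)
  also have "\<dots> \<longleftrightarrow> op_closed G (set_decode ` set_decode s)"
  proof -
    \<comment> \<open>Lists over an image are the images of lists, so lists of sets can be traded
      for lists of masks.\<close>
    have "(\<forall>As. length As = n \<longrightarrow> set As \<subseteq> set_decode ` set_decode s \<longrightarrow> Q As) \<longleftrightarrow>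
        (\<forall>xs. length xs = n \<longrightarrow> set xs \<subseteq> set_decode s \<longrightarrow> Q (map set_decode xs))" for n Q
    proof safe
      fix As
      assume *: "\<forall>xs. length xs = length As \<longrightarrow> set xs \<subseteq> set_decode s \<longrightarrow> Q (map set_decode xs)"
        and "set As \<subseteq> set_decode ` set_decode s"
      then have "As \<in> lists (set_decode ` set_decode s)" by auto
      then obtain xs where "As = map set_decode xs" "xs \<in> lists (set_decode s)"
        unfolding lists_image by blast
      with * show "Q As" by (simp add: subset_iff in_lists_conv_set)
    next
      fix xs
      assume "\<forall>As. length As = length xs \<longrightarrow> set As \<subseteq> set_decode ` set_decode s \<longrightarrow> Q As"
        and "set xs \<subseteq> set_decode s"
      then show "Q (map set_decode xs)" by (simp add: image_mono)
    qed
    then show ?thesis unfolding op_closed_def by (simp only:)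
  qed
  finally show ?thesis .
qed

section \<open>Truth tables of coded formulae\<close>

text \<open>
  The list \<open>l\<close> is a valuation, and \<open>t\<close> is the set of codes below \<open>N\<close> of the true formulae.
  A number that codes no formula is read as one all the same, so that such a set always exists.
\<close>

definition truth_set :: "nat \<Rightarrow> nat \<Rightarrow> nat \<Rightarrow> bool" where
  "truth_set l N t \<longleftrightarrow> (\<forall>k<N. k \<in> set_decode t \<longleftrightarrow>
    pfst k = 0 \<or>
    (if pfst k = 1 then psnd (psnd k) \<in> set_decode (lnth l (pfst (psnd k)))
     else if pfst k = 2 then psnd k \<notin> set_decode t
     else pfst (psnd k) \<in> set_decode t \<and> psnd (psnd k) \<in> set_decode t))"

text \<open>With first component \<open>a > 0\<close>, the code \<open>triangle (a + b) + a\<close>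
  is at least \<open>a + b + a\<close>. Hence recursion on formula codes descends at every nonzero
  tag.\<close>

lemma psnd_less: "pfst k \<noteq> 0 \<Longrightarrow> psnd k < k"
proof -
  assume nz: "pfst k \<noteq> 0"
  obtain a b where k: "k = prod_encode (a, b)"
    by (metis prod_decode_inverse surj_pair)
  have "n \<le> triangle n" for n
    by (induction n) simp_all
  from this[of "a + b"] have "b < triangle (a + b) + a" if "a \<noteq> 0"
    using that by linarith
  moreover have "a \<noteq> 0"
    using nz k by simp
  ultimately have "b < k"
    by (simp add: k prod_encode_def)
  with k show "psnd k < k" by simp
qed

lemma pfst_le: "pfst k \<le> k" and psnd_le: "psnd k \<le> k"
  by (metis le_prod_encode_1 prod_decode_inverse surjective_pairing)
    (metis le_prod_encode_2 prod_decode_inverse surjective_pairing)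

text \<open>Made total to match \<open>truth_set\<close>: tag 0 gives \<open>TrueF\<close> whatever
  the payload, and every tag above 2 gives a conjunction.\<close>

function form_decode :: "nat \<Rightarrow> form" where
  "form_decode k =
    (if pfst k = 0 then TrueF
     else if pfst k = 1 then CanF (pfst (psnd k)) (psnd (psnd k))
     else if pfst k = 2 then NotF (form_decode (psnd k))
     else AndF (form_decode (pfst (psnd k))) (form_decode (psnd (psnd k))))"
  by pat_completeness auto
termination
  by (relation "measure id")
    (auto intro: psnd_less le_less_trans[OF pfst_le psnd_less] le_less_trans[OF psnd_le psnd_less])

declare form_decode.simps [simp del]

lemma form_decode_form_code: "form_decode (form_code F) = F"
  by (induction F) (simp_all add: form_decode.simps[of "prod_encode _"])

text \<open>The condition at \<open>k\<close> refers only to smaller codes, so it determines the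
  table on all numbers below \<open>N\<close>.\<close>

lemma truth_set_holds:
  assumes t: "truth_set l N t"
  shows "k < N \<Longrightarrow> k \<in> set_decode t \<longleftrightarrow> holds (\<lambda>x. set_decode (lnth l x)) (form_decode k)"
proof (induction k rule: less_induct)
  case (less k)
  have "psnd k < k \<and> pfst (psnd k) < k \<and> psnd (psnd k) < k" if "pfst k \<noteq> 0"
    using psnd_less[OF that] pfst_le[of "psnd k"] psnd_le[of "psnd k"] by simp
  with less have "pfst k \<noteq> 0 \<Longrightarrow> m \<in> {psnd k, pfst (psnd k), psnd (psnd k)} \<Longrightarrow>
      m \<in> set_decode t \<longleftrightarrow> holds (\<lambda>x. set_decode (lnth l x)) (form_decode m)" for m
    by auto
  moreover have "k \<in> set_decode t \<longleftrightarrow> pfst k = 0 \<or>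
    (if pfst k = 1 then psnd (psnd k) \<in> set_decode (lnth l (pfst (psnd k)))
     else if pfst k = 2 then psnd k \<notin> set_decode t
     else pfst (psnd k) \<in> set_decode t \<and> psnd (psnd k) \<in> set_decode t)"
    using t less.prems unfolding truth_set_def by blast
  ultimately show ?case
    by (subst form_decode.simps) simp
qed

lemma ex_truth_set: "\<exists>t<2 ^ N. truth_set l N t"
proof -
  let ?T = "{k. k < N \<and> holds (\<lambda>x. set_decode (lnth l x)) (form_decode k)}"
  have T: "set_decode (set_encode ?T) = ?T" by simp
  have "truth_set l N (set_encode ?T)"
    unfolding truth_set_def T
  proof (intro allI impI)
    fix k
    assume k: "k < N"
    \<comment> \<open>The numbers below \<open>N\<close> are closed under taking subformula codes,
      so restricting \<open>?T\<close> to them loses nothing.\<close>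
    then have "pfst (psnd k) < N" "psnd (psnd k) < N" "psnd k < N"
      using pfst_le[of "psnd k"] psnd_le[of "psnd k"] psnd_le[of k] by simp_all
    with k show "k \<in> ?T \<longleftrightarrow> pfst k = 0 \<or>
      (if pfst k = 1 then psnd (psnd k) \<in> set_decode (lnth l (pfst (psnd k)))
       else if pfst k = 2 then psnd k \<notin> ?T
       else pfst (psnd k) \<in> ?T \<and> psnd (psnd k) \<in> ?T)"
      by (simp add: form_decode.simps[of k])
  qed
  moreover have "set_encode ?T < 2 ^ N"
    unfolding set_decode_subset_iff[symmetric] T by auto
  ultimately show ?thesis by blast
qed

text \<open>Pairing dominates its components, so no variable of a formula exceeds its code; finitely
  many values of a valuation decide it.\<close>

lemma holds_cong:
  "(\<And>x. x \<le> form_code F \<Longrightarrow> \<rho> x = \<rho>' x) \<Longrightarrow> holds \<rho> F \<longleftrightarrow> holds \<rho>' F"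
proof (induction F)
  case (CanF x a)
  have "x \<le> form_code (CanF x a)"
    using le_prod_encode_1[of x a] le_prod_encode_2[of "prod_encode (x, a)" 1] by simp
  with CanF show ?case by simp
next
  case (NotF F)
  have "form_code F \<le> form_code (NotF F)"
    using le_prod_encode_2[of "form_code F" 2] by simp
  with NotF show ?case by (meson holds.simps(3) order_trans)
next
  case (AndF F1 F2)
  have "form_code F1 \<le> form_code (AndF F1 F2)" "form_code F2 \<le> form_code (AndF F1 F2)"
    using le_prod_encode_2[of "prod_encode (form_code F1, form_code F2)" 3]
      le_prod_encode_1[of "form_code F1" "form_code F2"]
      le_prod_encode_2[of "form_code F2" "form_code F1"] by simp_all
  with AndF show ?case by (meson holds.simps(4) order_trans)
qed simp

section \<open>Entailment in coded form\<close>

text \<open>\<open>Suc (u + v)\<close> exceeds both formula codes, so it serves as length of the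
  valuation list and of the truth table. The bound \<open>2 ^ 2 ^ g\<close> covers all sets of masks
  below \<open>2 ^ g\<close>.\<close>

definition entails_code :: "nat \<Rightarrow> nat \<Rightarrow> nat \<Rightarrow> bool" where
  "entails_code g u v \<longleftrightarrow> (\<exists>s<2 ^ 2 ^ g. op_closed_code g s \<and>
    (\<forall>l<list_bound (Suc (u + v)) (2 ^ g).
      llen l = Suc (u + v) \<and> (\<forall>i<llen l. lnth l i \<in> set_decode s) \<longrightarrow>
      (\<exists>t<2 ^ Suc (u + v). truth_set l (Suc (u + v)) t \<and>
        (u \<in> set_decode t \<longrightarrow> v \<in> set_decode t))))"

lemma valuations_code:
  fixes F F' :: form
  defines "N \<equiv> Suc (form_code F + form_code F')"
  shows "(\<forall>xs. length xs = N \<longrightarrow> set xs \<subseteq> set_decode s \<longrightarrow>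
      (\<exists>t<2 ^ N. truth_set (list_encode xs) N t \<and>
        (form_code F \<in> set_decode t \<longrightarrow> form_code F' \<in> set_decode t))) \<longleftrightarrow>
    (\<forall>\<rho>. range \<rho> \<subseteq> set_decode ` set_decode s \<longrightarrow> holds \<rho> F \<longrightarrow> holds \<rho> F')"
    (is "?L \<longleftrightarrow> ?R")
proof -
  define val where "val xs = (\<lambda>x. set_decode (lnth (list_encode xs) x))" for xs
  \<comment> \<open>A truth table exists, and all of them give the same verdict on \<open>F\<close>
    and \<open>F'\<close>.\<close>
  have table: "(\<exists>t<2 ^ N. truth_set (list_encode xs) N t \<and>
      (form_code F \<in> set_decode t \<longrightarrow> form_code F' \<in> set_decode t)) \<longleftrightarrow>
    (holds (val xs) F \<longrightarrow> holds (val xs) F')" for xs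
  proof -
    have "form_code F < N" "form_code F' < N"
      by (simp_all add: N_def)
    then have "(form_code F \<in> set_decode t \<longrightarrow> form_code F' \<in> set_decode t) \<longleftrightarrow>
        (holds (val xs) F \<longrightarrow> holds (val xs) F')"
      if "truth_set (list_encode xs) N t" for t
      using truth_set_holds[OF that] by (simp add: form_decode_form_code val_def)
    then show ?thesis
      using ex_truth_set[of N "list_encode xs"] by blast
  qed
  have agree: "holds (val xs) H \<longleftrightarrow> holds \<rho> H"
    if "length xs = N" "\<And>x. x < N \<Longrightarrow> \<rho> x = set_decode (xs ! x)" "form_code H < N" for xs \<rho> H
    using that by (intro holds_cong) (simp add: val_def lnth_list_encode)
  have N: "form_code F < N" "form_code F' < N" "0 < N"
    by (simp_all add: N_def)
  show ?thesis
    unfolding table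
  proof (intro iffI allI impI)
    fix \<rho> :: "var \<Rightarrow> action set"
    assume L: "\<forall>xs. length xs = N \<longrightarrow> set xs \<subseteq> set_decode s \<longrightarrow>
        holds (val xs) F \<longrightarrow> holds (val xs) F'"
      and \<rho>: "range \<rho> \<subseteq> set_decode ` set_decode s" and "holds \<rho> F"
    have "\<forall>x. \<exists>B. B \<in> set_decode s \<and> \<rho> x = set_decode B"
      using \<rho> by auto
    then obtain b where b: "b x \<in> set_decode s" "\<rho> x = set_decode (b x)" for x
      by metis
    define xs where "xs = map b [0..<N]"
    have "length xs = N" "set xs \<subseteq> set_decode s" and "\<And>x. x < N \<Longrightarrow> \<rho> x = set_decode (xs ! x)"
      using b by (auto simp: xs_def)
    with L \<open>holds \<rho> F\<close> show "holds \<rho> F'"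
      using agree N by blast
  next
    fix xs
    assume R: ?R and xs: "length xs = N" "set xs \<subseteq> set_decode s" and "holds (val xs) F"
    \<comment> \<open>Beyond the list, entry 0 is repeated to stay inside the family; it exists
      because \<open>N\<close> is positive. An empty family admits neither lists of length
      \<open>N\<close> nor valuations.\<close>
    define \<rho> where "\<rho> x = set_decode (xs ! (if x < N then x else 0))" for x
    have "range \<rho> \<subseteq> set_decode ` set_decode s"
      using xs N(3) by (auto simp: \<rho>_def intro!: imageI subsetD[OF xs(2)])
    then have "holds \<rho> F \<longrightarrow> holds \<rho> F'"
      using R by simp
    moreover have "holds (val xs) H \<longleftrightarrow> holds \<rho> H" if "form_code H < N" for H
      by (rule agree[OF xs(1) _ that]) (simp add: \<rho>_def)
    ultimately show "holds (val xs) F'"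
      using \<open>holds (val xs) F\<close> N by simp
  qed
qed

lemma entails_code_correct:
  assumes G: "gsos_language G"
  shows "entails_code (language_code G) (form_code F) (form_code F') \<longleftrightarrow> entails G F F'"
proof -
  let ?g = "language_code G"
  let ?ok = "\<lambda>S. op_closed G S \<and> (\<forall>\<rho>. range \<rho> \<subseteq> S \<longrightarrow> holds \<rho> F \<longrightarrow> holds \<rho> F')"
  have code: "entails_code ?g (form_code F) (form_code F') \<longleftrightarrow>
      (\<exists>s<2 ^ 2 ^ ?g. ?ok (set_decode ` set_decode s))"
    unfolding entails_code_def
    by (intro ex_cong1 conj_cong refl)
      (simp_all only: op_closed_code_correct all_list_code valuations_code)
  show ?thesis
    unfolding code entails_iff_op_closed[OF G]
  proof
    assume "\<exists>s<2 ^ 2 ^ ?g. ?ok (set_decode ` set_decode s)"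
    then obtain s where ok: "?ok (set_decode ` set_decode s)" by blast
    \<comment> \<open>Masks in \<open>s\<close> may contain numbers that are not labels. Discarding
      those sets preserves closure, as \<open>enabled\<close> yields only labels, and leaves fewer
      valuations to check.\<close>
    let ?S = "set_decode ` set_decode s \<inter> Pow (label ` set (rules G))"
    have labels: "enabled G f As \<in> Pow (label ` set (rules G))" for f As
      by (auto simp: enabled_def)
    have "op_closed G ?S"
      unfolding op_closed_def
    proof clarify
      fix f As
      assume f: "(f, length As) \<in> set (signature G)" and As: "set As \<subseteq> ?S"
      from ok have "\<forall>(f, n)\<in>set (signature G). \<forall>As. length As = n \<longrightarrow>
          set As \<subseteq> set_decode ` set_decode s \<longrightarrow> enabled G f As \<in> set_decode ` set_decode s"
        unfolding op_closed_def by (rule conjunct1)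
      from bspec[OF this f] As have "enabled G f As \<in> set_decode ` set_decode s"
        by simp
      then show "enabled G f As \<in> ?S"
        using labels by (rule IntI)
    qed
    moreover have "\<forall>\<rho>. range \<rho> \<subseteq> ?S \<longrightarrow> holds \<rho> F \<longrightarrow> holds \<rho> F'"
      using ok by simp
    ultimately show "\<exists>S \<subseteq> Pow (label ` set (rules G)). ?ok S"
      by (intro exI[of _ ?S] conjI) simp_all
  next
    assume "\<exists>S \<subseteq> Pow (label ` set (rules G)). ?ok S"
    then obtain S where S: "S \<subseteq> Pow (label ` set (rules G))" and ok: "?ok S" by blast
    have fin: "finite S" "\<And>A. A \<in> S \<Longrightarrow> finite A"
      using S by (auto intro: finite_subset[of _ "Pow (label ` set (rules G))"] finite_subset)
    \<comment> \<open>Finiteness at both levels permits coding each set as a mask and then the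
      family as a mask of these.\<close>
    let ?s = "set_encode (set_encode ` S)"
    have s: "set_decode ?s = set_encode ` S"
      using fin by simp
    have "set_encode A < 2 ^ ?g" if "A \<in> S" for A
      unfolding set_decode_subset_iff[symmetric]
      using that S fin label_less_language_code by fastforce
    then have "?s < 2 ^ 2 ^ ?g"
      unfolding set_decode_subset_iff[of ?s, symmetric] s by auto
    moreover have "set_decode ` set_decode ?s = S"
      unfolding s image_image using fin by simp
    ultimately show "\<exists>s<2 ^ 2 ^ ?g. ?ok (set_decode ` set_decode s)"
      using ok by metis
  qed
qed

section \<open>Computability of the procedure\<close>

lemma computable_pred_premises_code [computable_intros]:
  "computable a \<Longrightarrow> computable b \<Longrightarrow> computable_pred (\<lambda>e. premises_code (a e) (b e))"
proof (rule computable_pred_compose2)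
  show "computable_pred (\<lambda>z. premises_code (pfst z) (psnd z))"
    unfolding premises_code_def by (intro computable_intros)
qed

lemma computable_pred_enabled_code:
  "computable_pred (\<lambda>z. enabled_code (pfst z) (pfst (psnd z))
    (pfst (psnd (psnd z))) (psnd (psnd (psnd z))))"
  unfolding enabled_code_def by (intro computable_intros)

lemma computable_pred_enabled_code' [computable_intros]:
  assumes "computable R" "computable f" "computable l" "computable c"
  shows "computable_pred (\<lambda>e. enabled_code (R e) (f e) (l e) (c e))"
  using computable_pred_compose[OF computable_pred_enabled_code
      computable_prod_encode[OF assms(1) computable_prod_encode[OF assms(2)
        computable_prod_encode[OF assms(3,4)]]]] by simp

lemma computable_pred_op_closed_code [computable_intros]:
  "computable a \<Longrightarrow> computable b \<Longrightarrow> computable_pred (\<lambda>e. op_closed_code (a e) (b e))"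
proof (rule computable_pred_compose2)
  show "computable_pred (\<lambda>z. op_closed_code (pfst z) (psnd z))"
    unfolding op_closed_code_def by (intro computable_intros)
qed

lemma computable_pred_truth_set [computable_intros]:
  "computable a \<Longrightarrow> computable b \<Longrightarrow> computable c \<Longrightarrow>
    computable_pred (\<lambda>e. truth_set (a e) (b e) (c e))"
proof (rule computable_pred_compose3)
  show "computable_pred (\<lambda>z. truth_set (pfst z) (pfst (psnd z)) (psnd (psnd z)))"
    unfolding truth_set_def by (intro computable_intros)
qed

lemma computable_pred_entails_code:
  "computable_pred (\<lambda>z. entails_code (pfst z) (pfst (psnd z)) (psnd (psnd z)))"
  unfolding entails_code_def by (intro computable_intros)

theorem theorem4p1:
  "decidable_on 3
    (\<lambda>(G, F, F'). [language_code G, form_code F, form_code F'])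
    {(G, F, F'). gsos_language G \<and> form_over G F \<and> form_over G F'}
    (\<lambda>(G, F, F'). entails G F F')"
proof -
  \<comment> \<open>The three input codes are packed into one environment, on which the unary
    predicate is evaluated.\<close>
  have "recursive 3 (\<lambda>xs. (\<lambda>z. of_bool (entails_code (pfst z) (pfst (psnd z)) (psnd (psnd z))))
      (prod_encode (xs ! 0, prod_encode (xs ! 1, xs ! 2))))"
    using computable_pred_entails_code unfolding computable_pred_def computable_def
    by (rule recursive_compose1) (intro recursive_prod_encode recursive_nth; simp)
  then have "recursive 3 (\<lambda>xs. of_bool (entails_code (xs ! 0) (xs ! 1) (xs ! 2)))"
    by simp
  then show ?thesis
    unfolding decidable_on_def by (auto simp: entails_code_correct intro!: exI conjI)
qed

end
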